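(* Let $(x^k,\lambda^k)_{k\ge1}$ and $(\beta_k)_{k\ge 1}$ be generated by the IADMM algorithm described in the context with $P_k=0$ for all $k$, and assume that Step 1 of the algorithm is well-defined. Suppose that $g$ is strongly convex with parameter $\sigma_g>0$ and continuously differentiable, that $\nabla g$ is Lipschitz continuous with parameter $L_g$, and that $C$ has full row rank. Suppose there is $\bar\beta$ such that $\beta\le\beta_k\le\bar\beta$ for all $k$. Let $(x^*,\lambda^* )$ be a KKT solution of $\min\{f(y)+g(z): By+Cz=b\}$. Then $\mathcal L(x^k,\lambda^* )-\mathcal L(x^*,\lambda^* )$, $\|\mathcal A x^k-b\|^2$ and $\|\lambda^k-\lambda^*\|^2$ all converge to zero R-linearly as $k\to\infty$.
   Context: Problem: $\min\{f(y)+g(z): By+Cz=b\}$, where $B\in\mathbb R^{m\times n_1}$, $C\in\mathbb R^{m\times n_2}$, $b\in\mathbb R^m$, and $f:\mathbb R^{n_1}\to(-\infty,\infty]$ and $g$ on $\mathbb R^{n_2}$ are proper, lower semicontinuous and convex. Strong convexity of $g$ with parameter $\sigma_g>0$ means $g(x)-g(y)\ge\langle\xi,x-y\rangle+\frac{\sigma_g}{2}\|x-y\|^2$ for all $x,y\in\mathbb R^{n_2}$ and all $\xi\in\partial g(y)$. Notation: $x=(y,z)$, $\mathcal F(x)=f(y)+g(z)$, $\mathcal A x=By+Cz$, $\mathcal L(x,\lambda)=\mathcal F(x)+\langle\lambda,\mathcal A x-b\rangle$, $\|\cdot\|$ is the Euclidean norm. A triple $(y,z,\lambda)$ is a KKT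 solution if $0\in\partial f(y)+B^\top\lambda$, $0\in\partial g(z)+C^\top\lambda$ and $By+Cz-b=0$. The set of KKT solutions is assumed nonempty. For a symmetric positive semidefinite matrix $D$, $\|w\|_D=\sqrt{\langle w,Dw\rangle}$. A nonnegative sequence $a_k$ converges to zero R-linearly if, for all sufficiently large $k$, $a_k\le c\rho^k$ with constants $c>0$, $\rho\in(0,1)$. IADMM algorithm (with $P_k=0$): choose $x^1=(y^1,z^1)$, $\lambda^1$, constants $\gamma\in(1,\frac{1+\sqrt5}{2})$ and $\epsilon,\beta,\tau\in(0,1)$, an initial penalty $\beta_1\in[\beta,\infty)$, and a symmetric matrix $Q\succeq0$; set $Q_k=\beta_kQ$. For $k=1,2,\dots$: 1. $y^{k+1}\in\arg\min_y\{f(y)+\langle\lambda^k,By\rangle+\frac{\beta_k}{2}\|By+Cz^k-b\|^2\}$; 2. $z^{k+1}\in\arg\min_z\{g(z)+\langle\lambda^k,Cz\rangle+\frac{\beta_k}{2}\|By^{k+1}+Cz-b\|^2+\frac12\|z-z^k\|^2_{Q_k}\}$; 3. $\lambda^{k+1}=\lambda^k+\gamma\beta_k(By^{k+1}+Cz^{k+1}-b)$; 4. choose any $\beta_{k+1}\in\left[\max\{\beta,\tau\beta_k\},\ \sqrt{\beta_k^2+\frac{(1-\epsilon)\sigma_g\beta_k}{\lambda_{\max}(C^\top C+Q)}}\right]$. Every subproblem is assumed to be well-defined with an optimal solution. *)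

theory Defs
  imports "HOL-Analysis.Analysis"
begin

section \<open>Extended-real-valued convex functions\<close>

definition proper :: "('a \<Rightarrow> ereal) \<Rightarrow> bool" where
  "proper f \<longleftrightarrow> (\<forall>x. f x \<noteq> -\<infinity>) \<and> (\<exists>x. f x \<noteq> \<infinity>)"

definition lower_semicontinuous :: "('a::topological_space \<Rightarrow> ereal) \<Rightarrow> bool" where
  "lower_semicontinuous f \<longleftrightarrow> (\<forall>x. f x \<le> Liminf (at x) f)"

text \<open>Restricting the weight to the open interval avoids products of zero and infinity.\<close>

definition convex_ereal :: "('a::real_vector \<Rightarrow> ereal) \<Rightarrow> bool" where
  "convex_ereal f \<longleftrightarrow>
     (\<forall>x y. \<forall>t::real. 0 < t \<and> t < 1 \<longrightarrow>
        f ((1 - t) *\<^sub>R x + t *\<^sub>R y) \<le> ereal (1 - t) * f x + ereal t * f y)"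

definition subdifferential :: "('a::real_inner \<Rightarrow> ereal) \<Rightarrow> 'a \<Rightarrow> 'a set" where
  "subdifferential f y =
     {\<xi>. \<bar>f y\<bar> \<noteq> \<infinity> \<and> (\<forall>x. f x \<ge> f y + ereal (\<xi> \<bullet> (x - y)))}"

definition strongly_convex :: "real \<Rightarrow> ('a::real_inner \<Rightarrow> ereal) \<Rightarrow> bool" where
  "strongly_convex \<sigma> g \<longleftrightarrow>
     (\<forall>x y. \<forall>\<xi> \<in> subdifferential g y.
        g x - g y \<ge> ereal (\<xi> \<bullet> (x - y) + \<sigma> / 2 * (norm (x - y))\<^sup>2))"

section \<open>Matrices\<close>

definition sym_psd :: "real^'n^'n \<Rightarrow> bool" where
  "sym_psd D \<longleftrightarrow> transpose D = D \<and> (\<forall>w. 0 \<le> w \<bullet> (D *v w))"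

definition wnorm :: "real^'n^'n \<Rightarrow> real^'n \<Rightarrow> real" where
  "wnorm D w = sqrt (w \<bullet> (D *v w))"

text \<open>Intended for symmetric matrices, all of whose eigenvalues are real.\<close>

definition lambda_max :: "real^'n^'n \<Rightarrow> real" where
  "lambda_max D = Max {\<mu>. \<exists>v. v \<noteq> 0 \<and> D *v v = \<mu> *\<^sub>R v}"

section \<open>The linearly constrained two-block problem\<close>

definition objective ::
  "('a \<Rightarrow> ereal) \<Rightarrow> ('b \<Rightarrow> ereal) \<Rightarrow> 'a \<times> 'b \<Rightarrow> ereal" where
  "objective f g x = f (fst x) + g (snd x)"

definition constr_op ::
  "real^'n1^'m \<Rightarrow> real^'n2^'m \<Rightarrow> (real^'n1) \<times> (real^'n2) \<Rightarrow> real^'m" where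
  "constr_op B C x = B *v fst x + C *v snd x"

definition lagrangian ::
  "(real^'n1 \<Rightarrow> ereal) \<Rightarrow> (real^'n2 \<Rightarrow> ereal) \<Rightarrow> real^'n1^'m \<Rightarrow> real^'n2^'m \<Rightarrow> real^'m
    \<Rightarrow> (real^'n1) \<times> (real^'n2) \<Rightarrow> real^'m \<Rightarrow> ereal" where
  "lagrangian f g B C b x l = objective f g x + ereal (l \<bullet> (constr_op B C x - b))"

definition KKT_solution ::
  "(real^'n1 \<Rightarrow> ereal) \<Rightarrow> (real^'n2 \<Rightarrow> ereal) \<Rightarrow> real^'n1^'m \<Rightarrow> real^'n2^'m \<Rightarrow> real^'m
    \<Rightarrow> (real^'n1) \<times> (real^'n2) \<Rightarrow> real^'m \<Rightarrow> bool" where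
  "KKT_solution f g B C b x l \<longleftrightarrow>
     0 \<in> (\<lambda>\<xi>. \<xi> + transpose B *v l) ` subdifferential f (fst x) \<and>
     0 \<in> (\<lambda>\<xi>. \<xi> + transpose C *v l) ` subdifferential g (snd x) \<and>
     constr_op B C x - b = 0"

section \<open>The algorithm\<close>

text \<open>
  All sequences start at index 1; their values at index 0 are unconstrained. The sequence \<open>bk\<close>
  holds the penalties, \<open>bmin\<close> is their prescribed lower bound, and the proximal matrix of the
  second block in iteration \<open>k\<close> is \<open>bk k *\<^sub>R Q\<close>; there is no proximal term in the first block.
  Existence of the minimisers is part of the requirement that the iterates are minimisers.
\<close>

definition IADMM ::
  "(real^'n1 \<Rightarrow> ereal) \<Rightarrow> (real^'n2 \<Rightarrow> ereal) \<Rightarrow> real^'n1^'m \<Rightarrow> real^'n2^'m \<Rightarrow> real^'m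
    \<Rightarrow> real \<Rightarrow> real \<Rightarrow> real \<Rightarrow> real \<Rightarrow> real \<Rightarrow> real^'n2^'n2
    \<Rightarrow> (nat \<Rightarrow> real^'n1) \<Rightarrow> (nat \<Rightarrow> real^'n2) \<Rightarrow> (nat \<Rightarrow> real^'m) \<Rightarrow> (nat \<Rightarrow> real) \<Rightarrow> bool" where
  "IADMM f g B C b \<sigma> \<gamma> \<epsilon> bmin \<tau> Q y z l bk \<longleftrightarrow>
     1 < \<gamma> \<and> \<gamma> < (1 + sqrt 5) / 2 \<and>
     0 < \<epsilon> \<and> \<epsilon> < 1 \<and> 0 < bmin \<and> bmin < 1 \<and> 0 < \<tau> \<and> \<tau> < 1 \<and>
     bmin \<le> bk 1 \<and> sym_psd Q \<and>
     (\<forall>k\<ge>1.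
        is_arg_min
          (\<lambda>u. f u + ereal (l k \<bullet> (B *v u) + bk k / 2 * (norm (B *v u + C *v z k - b))\<^sup>2))
          (\<lambda>_. True) (y (Suc k)) \<and>
        is_arg_min
          (\<lambda>w. g w + ereal (l k \<bullet> (C *v w)
                    + bk k / 2 * (norm (B *v y (Suc k) + C *v w - b))\<^sup>2
                    + 1 / 2 * (wnorm (bk k *\<^sub>R Q) (w - z k))\<^sup>2))
          (\<lambda>_. True) (z (Suc k)) \<and>
        l (Suc k) = l k + (\<gamma> * bk k) *\<^sub>R (B *v y (Suc k) + C *v z (Suc k) - b) \<and>
        bk (Suc k) \<in> {max bmin (\<tau> * bk k) ..
          sqrt ((bk k)\<^sup>2 + (1 - \<epsilon>) * \<sigma> * bk k / lambda_max (transpose C ** C + Q))})"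

section \<open>R-linear convergence\<close>

text \<open>
  For sequences indexed from 1. The values are extended reals because the Lagrangian may be
  infinite at the arbitrary starting point.
\<close>

definition R_linearly_to_zero :: "(nat \<Rightarrow> ereal) \<Rightarrow> bool" where
  "R_linearly_to_zero a \<longleftrightarrow>
     (\<forall>k\<ge>1. 0 \<le> a k) \<and>
     (\<exists>c>0. \<exists>\<rho>::real. 0 < \<rho> \<and> \<rho> < 1 \<and> (\<forall>\<^sub>F k in sequentially. a k \<le> ereal (c * \<rho> ^ k)))"

end

theory Submission
  imports Defs
begin

text \<open>
  The proof is a Lyapunov argument. Write r^k = By^k + Cz^k - b, M = C^T C + Q and
  \<Delta>^{k+1} = z^{k+1} - z^k. Testing the optimality conditions of the two subproblems at a KKT
  point, with strong convexity of g for the second one, gives an estimate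
  (\<open>basic_inequality\<close>) which says that (1/\<gamma>) \<parallel>\<lambda>^k-\<lambda>^*\<parallel>^2 +
  \<beta>_k^2\<parallel>z^k-z^*\<parallel>_M^2 decreases, up to two obstacles.

  First, the weight \<beta>_k^2 may grow. The upper bound in the penalty rule is made so that the
  growth costs at most (1-\<epsilon>)\<sigma>\<beta>_k\<parallel>z^{k+1}-z^*\<parallel>^2 (\<open>penalty_growth\<close>),
  because lambda_max M dominates the Rayleigh quotient of M
  (\<open>quadratic_form_le_lambda_max\<close>); a fraction \<epsilon> of the strong convexity term is
  left over.

  Second, there is an indefinite cross term \<langle> r^{k+1}, C\<Delta>^{k+1}\<rangle>. Monotonicity of
  \<partial> g between two consecutive iterates z^k and z^{k+1} trades it for
  (\<gamma>-1)^2\<beta>_{k-1}^2\<parallel>r^k\<parallel>^2 + \<beta>_{k-1}^2\<parallel>\<Delta>^k\<parallel>_Q^2, quantities of the previous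
  iteration that are added to the Lyapunov function (\<open>cross_term_bound\<close>). The balance of
  the residual terms is then 2-\<gamma>-(\<gamma>-1)^2 = 1+\<gamma>-\<gamma>^2, which is positive exactly
  because \<gamma> is below the golden ratio. The result is the descent estimate
  \<open>potential_descent\<close>.

  The decrease contains \<parallel>z^{k+1}-z^*\<parallel>^2, \<parallel>r^{k+1}\<parallel>^2 and \<parallel>\<Delta>^{k+1}\<parallel>^2 but not the
  multiplier error. This is where smoothness of g and the rank of C enter: the second optimality
  condition expresses C^T(\<lambda>^{k+1}-\<lambda>^*) through
  \<nabla> g(z^{k+1})-\<nabla> g(z^*), r^{k+1} and \<Delta>^{k+1}, and C^T is bounded below. So
  the decrease controls a fixed fraction of the Lyapunov function
  (\<open>potential_le_dissipation\<close>), which therefore decays geometrically and carries the three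
  quantities of the theorem with it.
\<close>

section \<open>Subgradients\<close>

text \<open>
  First-order optimality of a subproblem: comparing the minimiser x with points
  x + t(u - x), using convexity of \<open>f\<close> and letting t \<rightarrow> 0 removes the quadratic
  remainder. All subproblems have an exactly quadratic smooth part, so the Taylor expansion is an
  identity, and \<open>q\<close> is its second-order term.
\<close>
lemma subgradient_of_quadratically_perturbed_minimizer:
  fixes f :: "'a::real_inner \<Rightarrow> ereal" and h q :: "'a \<Rightarrow> real"
  assumes "proper f" and "convex_ereal f"
    and min: "is_arg_min (\<lambda>u. f u + ereal (h u)) (\<lambda>_. True) x"
    and expand: "\<And>t d. h (x + t *\<^sub>R d) = h x + t * (p \<bullet> d) + t\<^sup>2 * q d"
  shows "- p \<in> subdifferential f x"
proof -
  have nminf: "f u \<noteq> -\<infinity>" for u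
    using \<open>proper f\<close> by (simp add: proper_def)
  obtain u0 where u0: "f u0 \<noteq> \<infinity>"
    using \<open>proper f\<close> by (auto simp: proper_def)
  have le: "f x + ereal (h x) \<le> f u + ereal (h u)" for u
    using min by (auto simp: is_arg_min_def not_less)
  have "f x \<noteq> \<infinity>"
    using le[of u0] u0 by auto
  then obtain fx where fx: "f x = ereal fx"
    using nminf[of x] by (cases "f x") auto
  have "f x + ereal (- p \<bullet> (u - x)) \<le> f u" for u
  proof (cases "f u")
    case (real fu)
    have step: "fx - fu - p \<bullet> (u - x) \<le> t * q (u - x)" if t: "0 < t" "t < 1" for t
    proof -
      have "f (x + t *\<^sub>R (u - x)) \<le> ereal (1 - t) * f x + ereal t * f u"
        using \<open>convex_ereal f\<close>[unfolded convex_ereal_def, rule_format, of t x u] t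
        by (simp add: algebra_simps)
      then have "f (x + t *\<^sub>R (u - x)) \<le> ereal ((1 - t) * fx + t * fu)"
        by (simp add: fx real)
      with le[of "x + t *\<^sub>R (u - x)"]
      have "ereal fx + ereal (h x)
          \<le> ereal ((1 - t) * fx + t * fu) + ereal (h (x + t *\<^sub>R (u - x)))"
        unfolding fx by (meson add_right_mono order_trans)
      then have "t * (fx - fu - p \<bullet> (u - x)) \<le> t * (t * q (u - x))"
        unfolding expand by (simp add: algebra_simps power2_eq_square)
      with t show ?thesis by simp
    qed
    have "((\<lambda>t. t * q (u - x)) \<longlongrightarrow> 0 * q (u - x)) (at_right 0)"
      by (intro tendsto_intros)
    moreover have "\<forall>\<^sub>F t in at_right 0. fx - fu - p \<bullet> (u - x) \<le> t * q (u - x)"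
      unfolding eventually_at_right_field using step by (intro exI[of _ 1]) auto
    ultimately have "fx - fu - p \<bullet> (u - x) \<le> 0 * q (u - x)"
      by (intro tendsto_lowerbound) auto
    then show ?thesis by (simp add: fx real)
  qed (use nminf in auto)
  then show ?thesis by (simp add: subdifferential_def fx)
qed

text \<open>
  The function g - \<langle>\<xi>,_\<rangle> has a minimum at \<open>w\<close>, so its derivative vanishes
  there. Thus the Lipschitz bound on the gradient applies to the subgradients produced by the
  algorithm.
\<close>
lemma subgradient_eq_gradient:
  fixes g :: "'a::euclidean_space \<Rightarrow> real"
  assumes "GDERIV g w :> G" and sub: "\<xi> \<in> subdifferential (\<lambda>w. ereal (g w)) w"
  shows "\<xi> = G"
proof -
  have "((\<lambda>x. g x - \<xi> \<bullet> x) has_derivative (\<lambda>d. d \<bullet> G - \<xi> \<bullet> d)) (at w)"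
    using assms(1) unfolding gderiv_def by (auto intro!: derivative_eq_intros)
  moreover have "\<forall>x\<in>UNIV. g w - \<xi> \<bullet> w \<le> g x - \<xi> \<bullet> x"
    using sub by (auto simp: subdifferential_def inner_diff_right algebra_simps)
  ultimately have "(\<lambda>d. d \<bullet> G - \<xi> \<bullet> d) = (\<lambda>d. 0)"
    using differential_zero_maxmin[of w UNIV] by blast
  then have "(G - \<xi>) \<bullet> (G - \<xi>) = 0"
    by (drule_tac x = "G - \<xi>" in fun_cong) (simp add: inner_commute inner_diff_left)
  then show ?thesis by simp
qed

lemma strongly_convex_subgradient_monotone:
  assumes sc: "strongly_convex s (\<lambda>w. ereal (g w))"
    and x: "\<xi> \<in> subdifferential (\<lambda>w. ereal (g w)) x"
    and y: "\<eta> \<in> subdifferential (\<lambda>w. ereal (g w)) y"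
  shows "s * (norm (x - y))\<^sup>2 \<le> (\<xi> - \<eta>) \<bullet> (x - y)"
proof -
  have "g y - g x \<ge> \<xi> \<bullet> (y - x) + s / 2 * (norm (y - x))\<^sup>2"
    and "g x - g y \<ge> \<eta> \<bullet> (x - y) + s / 2 * (norm (x - y))\<^sup>2"
    using sc x y by (auto simp: strongly_convex_def)
  then show ?thesis
    by (simp add: norm_minus_commute inner_diff_left inner_diff_right)
qed

section \<open>Matrix bounds\<close>

text \<open>
  Eigenvectors of a symmetric matrix for distinct eigenvalues are orthogonal. Finiteness is what
  makes the maximum in \<open>lambda_max\<close> meaningful.
\<close>
lemma finite_eigenvalues_symmetric:
  fixes D :: "real^'n^'n"
  assumes sym: "transpose D = D"
  shows "finite {\<mu>. \<exists>v. v \<noteq> 0 \<and> D *v v = \<mu> *\<^sub>R v}" (is "finite ?S")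
proof -
  have "\<forall>\<mu>\<in>?S. \<exists>v. v \<noteq> 0 \<and> D *v v = \<mu> *\<^sub>R v" by blast
  then obtain V where V: "\<And>\<mu>. \<mu> \<in> ?S \<Longrightarrow> V \<mu> \<noteq> 0 \<and> D *v V \<mu> = \<mu> *\<^sub>R V \<mu>"
    unfolding bchoice_iff by blast
  have orth: "V \<mu> \<bullet> V \<nu> = 0" if "\<mu> \<in> ?S" "\<nu> \<in> ?S" "\<mu> \<noteq> \<nu>" for \<mu> \<nu>
  proof -
    have "(D *v V \<mu>) \<bullet> V \<nu> = V \<mu> \<bullet> (D *v V \<nu>)"
      using dot_lmul_matrix[of "V \<mu>" D "V \<nu>"] sym
      by (metis transpose_matrix_vector)
    then have "\<mu> * (V \<mu> \<bullet> V \<nu>) = \<nu> * (V \<mu> \<bullet> V \<nu>)"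
      using V[OF that(1)] V[OF that(2)] by simp
    with \<open>\<mu> \<noteq> \<nu>\<close> show ?thesis by simp
  qed
  have "inj_on V ?S"
  proof (rule inj_onI, rule ccontr)
    fix \<mu> \<nu>
    assume \<mu>\<nu>: "\<mu> \<in> ?S" "\<nu> \<in> ?S" "\<mu> \<noteq> \<nu>" and "V \<mu> = V \<nu>"
    with orth[OF \<mu>\<nu>] have "V \<mu> \<bullet> V \<mu> = 0" by simp
    with V[OF \<mu>\<nu>(1)] show False by simp
  qed
  moreover have "finite (V ` ?S)"
  proof (rule pairwise_orthogonal_imp_finite)
    show "pairwise orthogonal (V ` ?S)"
      using orth unfolding pairwise_def orthogonal_def by blast
  qed
  ultimately show ?thesis by (rule finite_imageD[rotated])
qed

text \<open>
  The form attains its maximum \<mu> over the unit sphere at some v. Then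
  h(x) = \<mu>\<parallel>x\<parallel>^2 - \<langle> x, Dx\<rangle> is nonnegative with a zero at v, so its gradient
  2(\<mu> v - Dv) vanishes there. Hence \<mu> is an eigenvalue.
\<close>
lemma quadratic_form_le_lambda_max:
  fixes D :: "real^'n^'n"
  assumes sym: "transpose D = D"
  shows "w \<bullet> (D *v w) \<le> lambda_max D * (norm w)\<^sup>2"
proof -
  have selfadj: "x \<bullet> (D *v y) = (D *v x) \<bullet> y" for x y
    using dot_lmul_matrix[of x D y] sym by (metis transpose_matrix_vector)
  have "compact (sphere 0 1 :: (real^'n) set)" "sphere 0 1 \<noteq> ({} :: (real^'n) set)"
    by simp_all
  moreover have "continuous_on (sphere 0 1) (\<lambda>x. x \<bullet> (D *v x))"
    by (intro continuous_intros linear_continuous_on matrix_vector_mul_bounded_linear)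
  ultimately obtain v where v: "norm v = 1"
    and max: "\<And>x. norm x = 1 \<Longrightarrow> x \<bullet> (D *v x) \<le> v \<bullet> (D *v v)"
    using continuous_attains_sup[of "sphere 0 1" "\<lambda>x. x \<bullet> (D *v x)"] by auto
  define \<mu> where "\<mu> = v \<bullet> (D *v v)"
  define h where "h x = \<mu> * (x \<bullet> x) - x \<bullet> (D *v x)" for x
  have h_nonneg: "0 \<le> h x" for x
  proof (cases "x = 0")
    case False
    define e where "e = x /\<^sub>R norm x"
    have "norm e = 1" using False by (simp add: e_def)
    from max[OF this] have "(norm x)\<^sup>2 * (e \<bullet> (D *v e)) \<le> (norm x)\<^sup>2 * \<mu>"
      by (intro mult_left_mono) (auto simp: \<mu>_def)
    also have "(norm x)\<^sup>2 * (e \<bullet> (D *v e)) = x \<bullet> (D *v x)"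
      using False by (simp add: e_def matrix_vector_mult_scaleR power2_eq_square field_simps)
    finally show ?thesis by (simp add: h_def power2_norm_eq_inner mult.commute)
  qed (simp add: h_def)
  \<comment> \<open>Moving from \<open>v\<close> against the gradient \<open>d\<close> would make \<open>h\<close> negative unless \<open>d = 0\<close>.\<close>
  define d where "d = \<mu> *\<^sub>R v - D *v v"
  have slope: "2 * (d \<bullet> d) \<le> t * h d" if "0 < t" for t
  proof -
    have "D *v (v - t *\<^sub>R d) = D *v v - t *\<^sub>R (D *v d)"
      by (simp add: matrix_vector_mult_diff_distrib matrix_vector_mult_scaleR)
    then have "h (v - t *\<^sub>R d) = h v - t * (2 * (\<mu> * (v \<bullet> d) - (D *v v) \<bullet> d)) + t * (t * h d)"
      using selfadj[of v d]
      by (simp add: h_def inner_diff_left inner_diff_right inner_commute algebra_simps)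
    also have "\<mu> * (v \<bullet> d) - (D *v v) \<bullet> d = d \<bullet> d"
      by (simp add: d_def inner_diff_left)
    finally have "h (v - t *\<^sub>R d) = h v - t * (2 * (d \<bullet> d)) + t * (t * h d)" .
    moreover have "h v = 0"
      using v by (simp add: h_def \<mu>_def flip: power2_norm_eq_inner)
    ultimately have "t * (2 * (d \<bullet> d)) \<le> t * (t * h d)"
      using h_nonneg[of "v - t *\<^sub>R d"] by simp
    with that show ?thesis by simp
  qed
  have "((\<lambda>t. t * h d) \<longlongrightarrow> 0 * h d) (at_right 0)"
    by (intro tendsto_intros)
  moreover have "\<forall>\<^sub>F t in at_right 0. 2 * (d \<bullet> d) \<le> t * h d"
    using slope unfolding eventually_at_right_field by (intro exI[of _ 1]) auto
  ultimately have "2 * (d \<bullet> d) \<le> 0 * h d"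
    by (intro tendsto_lowerbound) auto
  then have "d = 0"
    using inner_gt_zero_iff[of d] by (simp add: not_less[symmetric])
  then have "\<mu> \<in> {\<mu>. \<exists>v. v \<noteq> 0 \<and> D *v v = \<mu> *\<^sub>R v}"
    using v by (auto simp: d_def intro!: exI[of _ v])
  then have "\<mu> \<le> lambda_max D"
    unfolding lambda_max_def using finite_eigenvalues_symmetric[OF sym] by (intro Max_ge)
  then have "\<mu> * (norm w)\<^sup>2 \<le> lambda_max D * (norm w)\<^sup>2"
    by (intro mult_right_mono) auto
  with h_nonneg[of w] show ?thesis
    by (simp add: h_def power2_norm_eq_inner)
qed

lemma full_row_rank_bounds_transpose_below:
  fixes C :: "real^'n^'m"
  assumes "rank C = CARD('m)"
  obtains \<kappa> where "\<kappa> > 0" and "\<And>w. \<kappa> * (norm w)\<^sup>2 \<le> (norm (transpose C *v w))\<^sup>2"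
proof -
  have "inj ((*v) (transpose C))"
    using assms full_rank_injective[of "transpose C"] by (simp add: rank_transpose)
  then obtain B where "B > 0" and B: "\<And>w. B * norm w \<le> norm (transpose C *v w)"
    using linear_inj_bounded_below_pos[of "(*v) (transpose C)"] by auto
  show ?thesis
  proof
    show "B\<^sup>2 > 0" using \<open>B > 0\<close> by simp
    show "B\<^sup>2 * (norm w)\<^sup>2 \<le> (norm (transpose C *v w))\<^sup>2" for w
      using power_mono[OF B[of w], of 2] \<open>B > 0\<close> by (simp add: power_mult_distrib)
  qed
qed

section \<open>A criterion for R-linear convergence\<close>

text \<open>
  The shift \<open>j\<close> accounts for the fact that the decrease in one iteration bounds quantities of
  the following iterates.
\<close>
lemma R_linearly_to_zeroI:
  assumes nonneg: "\<And>k. k \<ge> 1 \<Longrightarrow> 0 \<le> a k"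
    and \<rho>: "0 < \<rho>" "\<rho> < 1"
    and le: "\<And>k. k \<ge> 1 \<Longrightarrow> a (k + j) \<le> ereal (c * \<rho> ^ k)"
  shows "R_linearly_to_zero a"
proof -
  define c' where "c' = (\<bar>c\<bar> + 1) / \<rho> ^ j"
  have bound: "a k \<le> ereal (c' * \<rho> ^ k)" if "k \<ge> j + 1" for k
  proof -
    define i where "i = k - j"
    then have i: "k = i + j" "i \<ge> 1" using that by auto
    have "c * \<rho> ^ i \<le> (\<bar>c\<bar> + 1) * \<rho> ^ i"
      using \<rho> by (intro mult_right_mono) auto
    also have "\<dots> = c' * \<rho> ^ k"
      using \<rho> by (simp add: c'_def i power_add)
    finally show ?thesis
      using le[OF i(2)] i(1) by (metis ereal_less_eq(3) order_trans)
  qed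
  have "c' > 0" using \<rho> by (simp add: c'_def)
  moreover have "\<forall>\<^sub>F k in sequentially. a k \<le> ereal (c' * \<rho> ^ k)"
    unfolding eventually_sequentially using bound by blast
  ultimately show ?thesis
    unfolding R_linearly_to_zero_def using nonneg \<rho> by (meson order.refl)
qed

section \<open>The algorithm at a KKT point\<close>

lemma norm_add_scaleR_squared:
  "(norm (c + t *\<^sub>R v))\<^sup>2 = (norm c)\<^sup>2 + t * (2 * (c \<bullet> v)) + t\<^sup>2 * (norm v)\<^sup>2"
  unfolding power2_norm_eq_inner
  by (simp add: inner_add_left inner_add_right inner_commute power2_eq_square algebra_simps)

lemma inner_transpose_mult:
  fixes A :: "real^'n^'m"
  shows "(transpose A *v u) \<bullet> d = u \<bullet> (A *v d)"
  by (simp add: transpose_matrix_vector dot_lmul_matrix)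

locale iadmm_run =
  fixes f :: "real^'n1 \<Rightarrow> ereal" and g :: "real^'n2 \<Rightarrow> real"
    and gradg :: "real^'n2 \<Rightarrow> real^'n2"
    and B :: "real^'n1^'m" and C :: "real^'n2^'m" and b :: "real^'m"
    and Q :: "real^'n2^'n2"
    and y :: "nat \<Rightarrow> real^'n1" and z :: "nat \<Rightarrow> real^'n2" and l :: "nat \<Rightarrow> real^'m"
    and bk :: "nat \<Rightarrow> real"
    and ys :: "real^'n1" and zs :: "real^'n2" and ls :: "real^'m"
    and \<sigma> L \<gamma> \<epsilon> bmin bmax \<tau> :: real
  assumes f_proper: "proper f" and f_convex: "convex_ereal f"
    and g_convex: "convex_ereal (\<lambda>w. ereal (g w))"
    and \<sigma>_pos: "\<sigma> > 0" and strong: "strongly_convex \<sigma> (\<lambda>w. ereal (g w))"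
    and gradient: "\<And>w. GDERIV g w :> gradg w"
    and lipschitz: "L-lipschitz_on UNIV gradg"
    and full_row_rank: "rank C = CARD('m)"
    and algorithm: "IADMM f (\<lambda>w. ereal (g w)) B C b \<sigma> \<gamma> \<epsilon> bmin \<tau> Q y z l bk"
    and penalties: "\<And>k. k \<ge> 1 \<Longrightarrow> bmin \<le> bk k \<and> bk k \<le> bmax"
    and KKT: "KKT_solution f (\<lambda>w. ereal (g w)) B C b (ys, zs) ls"
begin

definition res :: "nat \<Rightarrow> real^'m" where
  "res k = B *v y k + C *v z k - b"

text \<open>
  The quadratic forms of \<open>Q\<close> and of M = C^T C + Q; \<open>qQ\<close> is used in place of
  \<open>wnorm\<close> to avoid square roots.
\<close>
definition qQ :: "real^'n2 \<Rightarrow> real" where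
  "qQ w = w \<bullet> (Q *v w)"

definition qM :: "real^'n2 \<Rightarrow> real" where
  "qM w = (norm (C *v w))\<^sup>2 + qQ w"

lemma constants: "1 < \<gamma>" "0 < \<epsilon>" "\<epsilon> < 1" "0 < bmin" "transpose Q = Q"
  and qQ_nonneg: "0 \<le> qQ w"
  using algorithm by (auto simp: IADMM_def sym_psd_def qQ_def)

text \<open>The golden ratio is the positive root of 1 + \<gamma> - \<gamma>^2.\<close>
lemma golden_ratio_bound: "0 < 1 + \<gamma> - \<gamma>\<^sup>2"
proof -
  have "2 * \<gamma> - 1 < sqrt 5"
    using algorithm by (simp add: IADMM_def field_simps)
  then have "(2 * \<gamma> - 1)\<^sup>2 < (sqrt 5)\<^sup>2"
    using constants by (intro power_strict_mono) auto
  then show ?thesis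
    by (simp add: power2_eq_square algebra_simps)
qed

lemma penalty_pos: "k \<ge> 1 \<Longrightarrow> 0 < bk k"
  using penalties constants(4) by fastforce

lemma multiplier_step: "k \<ge> 1 \<Longrightarrow> l (Suc k) = l k + (\<gamma> * bk k) *\<^sub>R res (Suc k)"
  using algorithm by (simp add: IADMM_def res_def)

lemma Q_selfadjoint: "(Q *v u) \<bullet> w = u \<bullet> (Q *v w)"
  using inner_transpose_mult[of Q u w] constants(5) by simp

lemma qQ_add: "qQ (u + w) = qQ u + 2 * ((Q *v u) \<bullet> w) + qQ w"
  using Q_selfadjoint[of u w]
  by (simp add: qQ_def matrix_vector_right_distrib inner_add_left inner_add_right inner_commute)

lemma qQ_scaleR: "qQ (t *\<^sub>R w) = t\<^sup>2 * qQ w"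
  by (simp add: qQ_def matrix_vector_mult_scaleR power2_eq_square)

lemma qQ_diff: "qQ (u - w) = qQ u - 2 * ((Q *v u) \<bullet> w) + qQ w"
  using qQ_add[of u "- w"] qQ_scaleR[of "-1" w] by simp

text \<open>
  The residual seen by the first block is By^{k+1} + Cz^k - b; it is written as
  r^{k+1} - C(z^{k+1}-z^k) since the later estimates are in terms of r^{k+1}.
\<close>
lemma y_subgradient:
  assumes "k \<ge> 1"
  shows "- (transpose B *v (l k + bk k *\<^sub>R (res (Suc k) - C *v (z (Suc k) - z k))))
    \<in> subdifferential f (y (Suc k))"
proof -
  define h where "h u = l k \<bullet> (B *v u) + bk k / 2 * (norm (B *v u + C *v z k - b))\<^sup>2" for u
  let ?c = "res (Suc k) - C *v (z (Suc k) - z k)"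
  have c: "?c = B *v y (Suc k) + C *v z k - b"
    by (simp add: res_def matrix_vector_mult_diff_distrib)
  have arg: "B *v (y (Suc k) + t *\<^sub>R d) + C *v z k - b = ?c + t *\<^sub>R (B *v d)" for t d
    unfolding c by (simp add: matrix_vector_right_distrib matrix_vector_mult_scaleR)
  show ?thesis
  proof (rule subgradient_of_quadratically_perturbed_minimizer[OF f_proper f_convex])
    show "is_arg_min (\<lambda>u. f u + ereal (h u)) (\<lambda>_. True) (y (Suc k))"
      using algorithm assms by (simp add: IADMM_def h_def)
    show "h (y (Suc k) + t *\<^sub>R d) = h (y (Suc k))
        + t * ((transpose B *v (l k + bk k *\<^sub>R ?c)) \<bullet> d) + t\<^sup>2 * (bk k / 2 * (norm (B *v d))\<^sup>2)"
      for t d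
      unfolding h_def arg norm_add_scaleR_squared inner_transpose_mult c[symmetric]
      by (simp add: matrix_vector_right_distrib matrix_vector_mult_scaleR inner_add_left
          inner_add_right algebra_simps)
  qed
qed

text \<open>The subgradient of \<open>g\<close> at z^{k+1} that optimality of the second block provides.\<close>
definition zsub :: "nat \<Rightarrow> real^'n2" where
  "zsub k = - (transpose C *v (l k + bk k *\<^sub>R res (Suc k)) + bk k *\<^sub>R (Q *v (z (Suc k) - z k)))"

lemma inner_zsub:
  "zsub k \<bullet> d
    = - ((l k + bk k *\<^sub>R res (Suc k)) \<bullet> (C *v d)) - bk k * ((Q *v (z (Suc k) - z k)) \<bullet> d)"
  unfolding zsub_def inner_minus_left inner_add_left[of "_ *v _"] inner_transpose_mult by simp

lemma z_subgradient:
  assumes "k \<ge> 1"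
  shows "zsub k \<in> subdifferential (\<lambda>w. ereal (g w)) (z (Suc k))"
proof -
  define h where "h w = l k \<bullet> (C *v w) + bk k / 2 * (norm (B *v y (Suc k) + C *v w - b))\<^sup>2
    + 1 / 2 * (wnorm (bk k *\<^sub>R Q) (w - z k))\<^sup>2" for w
  have wnorm: "(wnorm (bk k *\<^sub>R Q) w)\<^sup>2 = bk k * qQ w" for w
    using qQ_nonneg[of w] penalty_pos[OF assms]
    by (simp add: wnorm_def qQ_def scaleR_matrix_vector_assoc[symmetric])
  have arg: "B *v y (Suc k) + C *v (z (Suc k) + t *\<^sub>R d) - b = res (Suc k) + t *\<^sub>R (C *v d)"
    for t d
    by (simp add: res_def matrix_vector_right_distrib matrix_vector_mult_scaleR algebra_simps)
  have prox_arg: "z (Suc k) + t *\<^sub>R d - z k = (z (Suc k) - z k) + t *\<^sub>R d" for t d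
    by simp
  have "- (- zsub k) \<in> subdifferential (\<lambda>w. ereal (g w)) (z (Suc k))"
  proof (rule subgradient_of_quadratically_perturbed_minimizer[OF _ g_convex])
    show "is_arg_min (\<lambda>w. ereal (g w) + ereal (h w)) (\<lambda>_. True) (z (Suc k))"
      using algorithm assms by (simp add: IADMM_def h_def)
    show "h (z (Suc k) + t *\<^sub>R d) = h (z (Suc k))
        + t * (- zsub k \<bullet> d) + t\<^sup>2 * (bk k / 2 * qM d)" for t d
      unfolding h_def arg prox_arg norm_add_scaleR_squared wnorm qQ_add qQ_scaleR inner_minus_left inner_zsub
        qM_def res_def[of "Suc k", symmetric]
      by (simp add: matrix_vector_right_distrib matrix_vector_mult_scaleR inner_add_left
          inner_add_right algebra_simps)
  qed (simp add: proper_def)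
  then show ?thesis by simp
qed

lemma solution_subgradients:
  shows ys_subgradient: "- (transpose B *v ls) \<in> subdifferential f ys"
    and zs_subgradient: "- (transpose C *v ls) \<in> subdifferential (\<lambda>w. ereal (g w)) zs"
    and feasible: "B *v ys = b - C *v zs"
  using KKT by (auto simp: KKT_solution_def constr_op_def eq_neg_iff_add_eq_0[symmetric]
      minus_equation_iff[of _ "_ *v _"] eq_diff_eq)

text \<open>
  As a minimiser of its subproblem, every iterate after the starting point lies in the domain of
  \<open>f\<close>, and so does the KKT point. At these points the passage to real numbers loses nothing and
  makes the energy estimates ordinary arithmetic; at the starting point f(y^1) = \<infty> is possible.
\<close>
definition fval :: "real^'n1 \<Rightarrow> real" where
  "fval u = real_of_ereal (f u)"

definition gap :: "nat \<Rightarrow> real" where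
  "gap k = fval (y k) + g (z k) - (fval ys + g zs) + ls \<bullet> res k"

lemma fval_subgradient:
  assumes "\<xi> \<in> subdifferential f u" and "\<eta> \<in> subdifferential f v"
  shows "fval u + \<xi> \<bullet> (v - u) \<le> fval v"
proof -
  have "ereal (fval u) = f u" "ereal (fval v) = f v"
    using assms by (auto simp: subdifferential_def fval_def ereal_real')
  moreover have "f u + ereal (\<xi> \<bullet> (v - u)) \<le> f v"
    using assms(1) by (simp add: subdifferential_def)
  ultimately show ?thesis
    by (metis ereal_less_eq(3) plus_ereal.simps(1))
qed

text \<open>
  The KKT conditions say that (y^*,z^*) minimises the convex function
  L(_, \<lambda>^*).
\<close>
lemma lagrangian_gap_nonneg:
  "0 \<le> lagrangian f (\<lambda>w. ereal (g w)) B C b (u, w) ls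
       - lagrangian f (\<lambda>w. ereal (g w)) B C b (ys, zs) ls"
proof -
  obtain fs where fs: "f ys = ereal fs"
    using ys_subgradient by (auto simp: subdifferential_def)
  have fu: "ereal (fs - ls \<bullet> (B *v (u - ys))) \<le> f u"
    using ys_subgradient by (auto simp: subdifferential_def fs dot_lmul_matrix
        dest!: spec[of _ u])
  have gw: "g zs - ls \<bullet> (C *v (w - zs)) \<le> g w"
    using zs_subgradient by (auto simp: subdifferential_def dot_lmul_matrix
        dest!: spec[of _ w])
  show ?thesis
  proof (cases "f u")
    case (real fr)
    then show ?thesis
      using fu gw by (simp add: lagrangian_def objective_def constr_op_def fs feasible
          matrix_vector_mult_diff_distrib inner_diff_right inner_add_right)
  qed (use fu in \<open>auto simp: lagrangian_def objective_def fs\<close>)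
qed

lemma lagrangian_gap_eq:
  assumes "k \<ge> 1"
  shows "lagrangian f (\<lambda>w. ereal (g w)) B C b (y (Suc k), z (Suc k)) ls
       - lagrangian f (\<lambda>w. ereal (g w)) B C b (ys, zs) ls = ereal (gap (Suc k))"
proof -
  have "f ys = ereal (fval ys)" "f (y (Suc k)) = ereal (fval (y (Suc k)))"
    using ys_subgradient y_subgradient[OF assms]
    by (auto simp: subdifferential_def fval_def ereal_real')
  then show ?thesis
    by (simp add: lagrangian_def objective_def constr_op_def gap_def res_def feasible)
qed

lemma gap_nonneg:
  assumes "k \<ge> 1"
  shows "0 \<le> gap (Suc k)"
  using lagrangian_gap_nonneg[of "y (Suc k)" "z (Suc k)"] lagrangian_gap_eq[OF assms] by simp

section \<open>Energy estimates for one iteration\<close>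

text \<open>
  Add the subgradient inequality of \<open>f\<close> at y^{k+1} and the strong convexity inequality of
  \<open>g\<close> at z^{k+1}, both tested at the KKT point, and multiply by 2\<beta>_k. Polarisation
  turns the inner products with \<lambda>^k-\<lambda>^* and with z^{k+1}-z^k into differences of
  squares. The factor 2-\<gamma> arises as 2 from the augmented term minus
  \<gamma> from \<parallel>\<lambda>^{k+1}-\<lambda>^k\<parallel>^2 = \<gamma>^2\<beta>_k^2\<parallel>r^{k+1}\<parallel>^2.
\<close>
lemma basic_inequality:
  assumes k: "k \<ge> 1"
  shows "2 * bk k * gap (Suc k)
      + ((norm (l (Suc k) - ls))\<^sup>2 - (norm (l k - ls))\<^sup>2) / \<gamma>
      + (2 - \<gamma>) * (bk k)\<^sup>2 * (norm (res (Suc k)))\<^sup>2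
      - 2 * (bk k)\<^sup>2 * (res (Suc k) \<bullet> (C *v (z (Suc k) - z k)))
      + (bk k)\<^sup>2 * (qM (z (Suc k) - zs) + qM (z (Suc k) - z k) - qM (z k - zs))
      + \<sigma> * bk k * (norm (z (Suc k) - zs))\<^sup>2 \<le> 0"
proof -
  define \<beta> r u v e where "\<beta> = bk k" and "r = res (Suc k)" and "u = C *v (z (Suc k) - zs)"
    and "v = C *v (z (Suc k) - z k)" and "e = l k - ls"
  define S where "S = (Q *v (z (Suc k) - z k)) \<bullet> (z (Suc k) - zs)"
  have "\<beta> > 0" using penalty_pos[OF k] by (simp add: \<beta>_def)
  have By: "B *v (ys - y (Suc k)) = u - r"
    by (simp add: u_def r_def res_def feasible matrix_vector_mult_diff_distrib)
  have "fval (y (Suc k)) + (l k + \<beta> *\<^sub>R (r - v)) \<bullet> (r - u) \<le> fval ys"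
    using fval_subgradient[OF y_subgradient[OF k] ys_subgradient]
    unfolding inner_minus_left inner_transpose_mult By
    by (simp add: \<beta>_def r_def v_def inner_diff_right)
  moreover have "g (z (Suc k)) + (l k + \<beta> *\<^sub>R r) \<bullet> u + \<beta> * S
      + \<sigma> / 2 * (norm (z (Suc k) - zs))\<^sup>2 \<le> g zs"
  proof -
    have "g zs - g (z (Suc k))
        \<ge> zsub k \<bullet> (zs - z (Suc k)) + \<sigma> / 2 * (norm (zs - z (Suc k)))\<^sup>2"
      using strong z_subgradient[OF k] by (auto simp: strongly_convex_def)
    moreover have "zsub k \<bullet> (zs - z (Suc k)) = - (zsub k \<bullet> (z (Suc k) - zs))"
      by (simp add: inner_diff_right)
    ultimately show ?thesis
      unfolding inner_zsub by (simp add: \<beta>_def r_def u_def S_def norm_minus_commute)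
  qed
  ultimately have "gap (Suc k) + (e + \<beta> *\<^sub>R r) \<bullet> r - \<beta> * (v \<bullet> r) + \<beta> * (v \<bullet> u) + \<beta> * S
      + \<sigma> / 2 * (norm (z (Suc k) - zs))\<^sup>2 \<le> 0"
    by (simp add: gap_def r_def[symmetric] e_def inner_diff_left inner_diff_right inner_add_left
        algebra_simps)
  then have "2 * \<beta> * (gap (Suc k) + (e + \<beta> *\<^sub>R r) \<bullet> r - \<beta> * (v \<bullet> r) + \<beta> * (v \<bullet> u) + \<beta> * S
      + \<sigma> / 2 * (norm (z (Suc k) - zs))\<^sup>2) \<le> 0"
    using \<open>\<beta> > 0\<close> by (simp add: mult_le_0_iff)
  then have combined: "2 * \<beta> * gap (Suc k) + 2 * \<beta> * (e \<bullet> r) + 2 * \<beta>\<^sup>2 * (norm r)\<^sup>2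
      - 2 * \<beta>\<^sup>2 * (r \<bullet> v) + \<beta>\<^sup>2 * (2 * (v \<bullet> u)) + \<beta>\<^sup>2 * (2 * S)
      + \<sigma> * \<beta> * (norm (z (Suc k) - zs))\<^sup>2 \<le> 0"
    by (simp add: inner_add_left dot_square_norm power2_eq_square inner_commute algebra_simps)
  have multiplier: "2 * \<beta> * (e \<bullet> r)
      = ((norm (l (Suc k) - ls))\<^sup>2 - (norm (l k - ls))\<^sup>2) / \<gamma> - \<gamma> * \<beta>\<^sup>2 * (norm r)\<^sup>2"
  proof -
    have "l (Suc k) - ls = e + (\<gamma> * \<beta>) *\<^sub>R r"
      by (simp add: multiplier_step[OF k] e_def \<beta>_def r_def)
    then have "(norm (l (Suc k) - ls))\<^sup>2
        = (norm e)\<^sup>2 + \<gamma> * (2 * \<beta> * (e \<bullet> r) + \<gamma> * \<beta>\<^sup>2 * (norm r)\<^sup>2)"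
      by (simp only: norm_add_scaleR_squared) (simp add: power2_eq_square algebra_simps)
    then show ?thesis using constants(1) by (simp add: e_def)
  qed
  have shift: "z k - zs = (z (Suc k) - zs) - (z (Suc k) - z k)" by simp
  have C_part: "2 * (v \<bullet> u) = (norm u)\<^sup>2 + (norm v)\<^sup>2 - (norm (C *v (z k - zs)))\<^sup>2"
    unfolding shift matrix_vector_mult_diff_distrib[of C "_ - _" "_ - _"] u_def[symmetric]
      v_def[symmetric]
    by (simp add: power2_norm_eq_inner inner_diff_left inner_diff_right inner_commute)
  have Q_part: "2 * S = qQ (z (Suc k) - zs) + qQ (z (Suc k) - z k) - qQ (z k - zs)"
    unfolding shift qQ_diff[of "z (Suc k) - zs" "z (Suc k) - z k"] S_def
    using Q_selfadjoint[of "z (Suc k) - zs" "z (Suc k) - z k"] by (simp add: inner_commute)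
  show ?thesis
    using combined unfolding multiplier C_part Q_part
    by (simp add: qM_def \<beta>_def r_def u_def v_def algebra_simps)
qed

text \<open>
  Strong monotonicity of \<partial> g between z^{k+1} and z^{k+2}. The multiplier step leaves
  (\<gamma>-1)\<beta>_k r^{k+1} as the contribution of the earlier residual. In Young's inequality for
  \<langle>(\<gamma>-1)\<beta>_k r^{k+1}, \<beta>_{k+1}C\<Delta>'\<rangle> both squares get weight one, so that
  \<parallel>C\<Delta>'\<parallel>^2 has exactly the coefficient with which it occurs in the basic inequality, and
  all the slack goes to the residual.
\<close>
lemma cross_term_bound:
  assumes k: "k \<ge> 1"
  defines "\<Delta> \<equiv> z (Suc k) - z k" and "\<Delta>' \<equiv> z (Suc (Suc k)) - z (Suc k)"
  shows "2 * (bk (Suc k))\<^sup>2 * (res (Suc (Suc k)) \<bullet> (C *v \<Delta>'))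
      + (bk (Suc k))\<^sup>2 * qQ \<Delta>' + 2 * \<sigma> * bk (Suc k) * (norm \<Delta>')\<^sup>2
    \<le> (\<gamma> - 1)\<^sup>2 * (bk k)\<^sup>2 * (norm (res (Suc k)))\<^sup>2 + (bk k)\<^sup>2 * qQ \<Delta>
      + (bk (Suc k))\<^sup>2 * (norm (C *v \<Delta>'))\<^sup>2"
proof -
  define \<beta> \<beta>' r r' v where "\<beta> = bk k" and "\<beta>' = bk (Suc k)" and "r = res (Suc k)"
    and "r' = res (Suc (Suc k))" and "v = C *v \<Delta>'"
  have "\<beta>' > 0" using penalty_pos[of "Suc k"] by (simp add: \<beta>'_def)
  have "\<sigma> * (norm \<Delta>')\<^sup>2 \<le> (zsub (Suc k) - zsub k) \<bullet> \<Delta>'"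
    unfolding \<Delta>'_def using k
    by (intro strongly_convex_subgradient_monotone[OF strong] z_subgradient) auto
  also have "\<dots> = - (\<beta>' * (r' \<bullet> v)) - (\<gamma> - 1) * \<beta> * (r \<bullet> v) - \<beta>' * qQ \<Delta>' + \<beta> * ((Q *v \<Delta>) \<bullet> \<Delta>')"
    unfolding inner_diff_left inner_zsub multiplier_step[OF k]
    by (simp add: \<beta>_def \<beta>'_def r_def r'_def v_def \<Delta>_def \<Delta>'_def qQ_def inner_commute
        inner_add_right algebra_simps)
  finally have "2 * \<beta>' * (\<sigma> * (norm \<Delta>')\<^sup>2)
      \<le> 2 * \<beta>' * (- (\<beta>' * (r' \<bullet> v)) - (\<gamma> - 1) * \<beta> * (r \<bullet> v) - \<beta>' * qQ \<Delta>' + \<beta> * ((Q *v \<Delta>) \<bullet> \<Delta>'))"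
    using \<open>\<beta>' > 0\<close> by (intro mult_left_mono) auto
  also have "\<dots> = - (2 * \<beta>'\<^sup>2 * (r' \<bullet> v)) - 2 * ((\<gamma> - 1) * \<beta> * \<beta>' * (r \<bullet> v)) - 2 * (\<beta>'\<^sup>2 * qQ \<Delta>')
      + 2 * (\<beta> * \<beta>' * ((Q *v \<Delta>) \<bullet> \<Delta>'))"
    by (simp add: power2_eq_square algebra_simps)
  finally have "2 * \<sigma> * \<beta>' * (norm \<Delta>')\<^sup>2
      \<le> - (2 * \<beta>'\<^sup>2 * (r' \<bullet> v)) - 2 * ((\<gamma> - 1) * \<beta> * \<beta>' * (r \<bullet> v)) - 2 * (\<beta>'\<^sup>2 * qQ \<Delta>')
        + 2 * (\<beta> * \<beta>' * ((Q *v \<Delta>) \<bullet> \<Delta>'))"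
    by (simp add: mult_ac)
  moreover have "0 \<le> (\<gamma> - 1)\<^sup>2 * \<beta>\<^sup>2 * (norm r)\<^sup>2 + 2 * ((\<gamma> - 1) * \<beta> * \<beta>' * (r \<bullet> v)) + \<beta>'\<^sup>2 * (norm v)\<^sup>2"
  proof -
    have "0 \<le> (norm (((\<gamma> - 1) * \<beta>) *\<^sub>R r + \<beta>' *\<^sub>R v))\<^sup>2" by simp
    also have "\<dots> = (\<gamma> - 1)\<^sup>2 * \<beta>\<^sup>2 * (norm r)\<^sup>2 + 2 * ((\<gamma> - 1) * \<beta> * \<beta>' * (r \<bullet> v)) + \<beta>'\<^sup>2 * (norm v)\<^sup>2"
      unfolding power2_norm_eq_inner inner_add_left inner_add_right
      by (simp add: inner_commute[of v r] power2_eq_square algebra_simps)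
    finally show ?thesis .
  qed
  moreover have "0 \<le> \<beta>\<^sup>2 * qQ \<Delta> - 2 * (\<beta> * \<beta>' * ((Q *v \<Delta>) \<bullet> \<Delta>')) + \<beta>'\<^sup>2 * qQ \<Delta>'"
    using qQ_nonneg[of "\<beta> *\<^sub>R \<Delta> - \<beta>' *\<^sub>R \<Delta>'"]
    by (simp add: qQ_diff qQ_scaleR matrix_vector_mult_scaleR mult_ac)
  ultimately show ?thesis
    unfolding \<beta>_def[symmetric] \<beta>'_def[symmetric] r_def[symmetric] r'_def[symmetric] v_def[symmetric]
    by linarith
qed

lemma qM_nonneg: "0 \<le> qM w"
  using qQ_nonneg by (simp add: qM_def)

definition lamM :: real where
  "lamM = lambda_max (transpose C ** C + Q)"

lemma qM_le: "qM w \<le> lamM * (norm w)\<^sup>2"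
proof -
  have "transpose (transpose C ** C + Q) = transpose C ** C + transpose Q"
    by (simp add: matrix_transpose_mul transpose_def matrix_matrix_mult_def vec_eq_iff
        mult.commute)
  then have "w \<bullet> ((transpose C ** C + Q) *v w) \<le> lamM * (norm w)\<^sup>2"
    unfolding lamM_def using constants(5) by (intro quadratic_form_le_lambda_max) simp
  also have "w \<bullet> ((transpose C ** C + Q) *v w) = qM w"
  proof -
    have "w \<bullet> ((transpose C ** C + Q) *v w) = w \<bullet> (transpose C *v (C *v w)) + qQ w"
      by (simp only: matrix_vector_mult_add_rdistrib inner_add_right qQ_def matrix_vector_mul_assoc)
    also have "w \<bullet> (transpose C *v (C *v w)) = (norm (C *v w))\<^sup>2"
      by (simp only: inner_commute[of w] inner_transpose_mult power2_norm_eq_inner)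
    finally show ?thesis by (simp add: qM_def)
  qed
  finally show ?thesis .
qed

lemma lamM_nonneg: "0 \<le> lamM"
proof -
  fix i :: 'n2
  have "0 \<le> lamM * (norm (axis i (1::real)))\<^sup>2"
    using qM_nonneg qM_le by (rule order_trans)
  then show ?thesis by (simp only: norm_axis_1 power_one mult_1_right)
qed

text \<open>
  Let M = C^T C + Q. By the upper bound of the penalty rule, the growth \<beta>_{k+1}^2 - \<beta>_k^2 is at most
  (1-\<epsilon>)\<sigma>\<beta>_k/lambda_max M, and
  \<parallel>w\<parallel>_M^2 \<le> lambda_max M * \<parallel>w\<parallel>^2.
\<close>
lemma penalty_growth:
  assumes k: "k \<ge> 1"
  shows "(bk (Suc k))\<^sup>2 * qM w \<le> (bk k)\<^sup>2 * qM w + (1 - \<epsilon>) * \<sigma> * bk k * (norm w)\<^sup>2"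
proof -
  define c where "c = (1 - \<epsilon>) * \<sigma> * bk k"
  have c: "0 \<le> c" using constants \<sigma>_pos penalty_pos[OF k] by (simp add: c_def)
  have "bk (Suc k) \<le> sqrt ((bk k)\<^sup>2 + c / lamM)"
    using algorithm k by (simp add: IADMM_def lamM_def c_def)
  then have "(bk (Suc k))\<^sup>2 \<le> (sqrt ((bk k)\<^sup>2 + c / lamM))\<^sup>2"
    using penalty_pos[of "Suc k"] by (intro power_mono) auto
  also have "\<dots> = (bk k)\<^sup>2 + c / lamM"
    using c lamM_nonneg by simp
  finally have "(bk (Suc k))\<^sup>2 * qM w \<le> ((bk k)\<^sup>2 + c / lamM) * qM w"
    by (intro mult_right_mono qM_nonneg)
  moreover have "((bk k)\<^sup>2 + c / lamM) * qM w = (bk k)\<^sup>2 * qM w + c * (qM w / lamM)"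
    by (simp only: distrib_right times_divide_eq_left times_divide_eq_right)
  moreover have "qM w / lamM \<le> (norm w)\<^sup>2"
    using qM_le[of w] lamM_nonneg by (cases "lamM = 0") (auto simp: pos_divide_le_eq mult.commute)
  then have "c * (qM w / lamM) \<le> c * (norm w)\<^sup>2"
    using c by (rule mult_left_mono)
  ultimately show ?thesis unfolding c_def by linarith
qed

section \<open>The Lyapunov function and its geometric decay\<close>

text \<open>
  \<open>potential k\<close> belongs to the iterate k+1, since it involves the residual and the
  displacement of z that iteration k produced. Accordingly \<open>dissipation k\<close> collects
  the terms that iteration k loses.
\<close>
definition potential :: "nat \<Rightarrow> real" where
  "potential k = (norm (l (Suc k) - ls))\<^sup>2 / \<gamma> + (bk (Suc k))\<^sup>2 * qM (z (Suc k) - zs)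
    + (\<gamma> - 1)\<^sup>2 * (bk k)\<^sup>2 * (norm (res (Suc k)))\<^sup>2 + (bk k)\<^sup>2 * qQ (z (Suc k) - z k)"

definition dissipation :: "nat \<Rightarrow> real" where
  "dissipation k = \<epsilon> * \<sigma> * bk k * (norm (z (Suc k) - zs))\<^sup>2 + 2 * bk k * gap (Suc k)
    + (1 + \<gamma> - \<gamma>\<^sup>2) * (bk k)\<^sup>2 * (norm (res (Suc k)))\<^sup>2
    + 2 * \<sigma> * bk k * (norm (z (Suc k) - z k))\<^sup>2"

text \<open>
  In the sum of \<open>basic_inequality\<close> (for the later iteration), \<open>cross_term_bound\<close>
  and \<open>penalty_growth\<close> the terms \<parallel>C\<Delta>'\<parallel>^2 cancel. Of the coefficient
  2-\<gamma> of the new residual, the part (\<gamma>-1)^2 is moved into the potential and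
  1+\<gamma>-\<gamma>^2 remains as dissipation.
\<close>
lemma potential_descent:
  assumes k: "k \<ge> 1"
  shows "potential (Suc k) + dissipation (Suc k) \<le> potential k"
proof -
  define A w \<Delta>' r r' where "A = (bk (Suc k))\<^sup>2" and "w = z (Suc (Suc k)) - zs"
    and "\<Delta>' = z (Suc (Suc k)) - z (Suc k)" and "r = (norm (res (Suc k)))\<^sup>2"
    and "r' = (norm (res (Suc (Suc k))))\<^sup>2"
  note folds = A_def[symmetric] w_def[symmetric] \<Delta>'_def[symmetric] r_def[symmetric]
    r'_def[symmetric]
  have basic: "2 * bk (Suc k) * gap (Suc (Suc k))
      + (norm (l (Suc (Suc k)) - ls))\<^sup>2 / \<gamma> - (norm (l (Suc k) - ls))\<^sup>2 / \<gamma>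
      + (1 + \<gamma> - \<gamma>\<^sup>2) * A * r' + (\<gamma> - 1)\<^sup>2 * A * r'
      - 2 * A * (res (Suc (Suc k)) \<bullet> (C *v \<Delta>'))
      + A * qM w + A * (norm (C *v \<Delta>'))\<^sup>2 + A * qQ \<Delta>' - A * qM (z (Suc k) - zs)
      + \<sigma> * bk (Suc k) * (norm w)\<^sup>2 \<le> 0"
  proof -
    have "(2 - \<gamma>) * A * r' = (1 + \<gamma> - \<gamma>\<^sup>2) * A * r' + (\<gamma> - 1)\<^sup>2 * A * r'"
      by (simp add: power2_eq_square algebra_simps)
    moreover have "A * (qM w + qM \<Delta>' - qM (z (Suc k) - zs))
        = A * qM w + A * (norm (C *v \<Delta>'))\<^sup>2 + A * qQ \<Delta>' - A * qM (z (Suc k) - zs)"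
      by (simp add: qM_def algebra_simps)
    ultimately show ?thesis
      using basic_inequality[of "Suc k"] unfolding folds diff_divide_distrib by linarith
  qed
  have growth: "(bk (Suc (Suc k)))\<^sup>2 * qM w
      \<le> A * qM w + \<sigma> * bk (Suc k) * (norm w)\<^sup>2 - \<epsilon> * \<sigma> * bk (Suc k) * (norm w)\<^sup>2"
    using penalty_growth[of "Suc k" w] unfolding folds by (simp add: left_diff_distrib)
  have "0 \<le> A * qQ \<Delta>'"
    using qQ_nonneg by (simp add: A_def)
  then show ?thesis
    using basic growth cross_term_bound[OF k]
    unfolding potential_def dissipation_def folds by linarith
qed

text \<open>
  Only the multiplier error needs work; all other terms of the potential also occur in the
  dissipation up to constants. By the optimality condition of the second block,
  C^T(\<lambda>^{k+1} - \<lambda>^* - (\<gamma>-1)\<beta>_k r^{k+1}) equals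
  \<nabla> g(z^*) - \<nabla> g(z^{k+1}) - \<beta>_k Q(z^{k+1}-z^k), and full row rank of C means
  that C^T is bounded below. The bounds on the penalties make the constant independent of k.
\<close>
lemma potential_le_dissipation:
  obtains K where "K > 0" and "\<And>k. k \<ge> 1 \<Longrightarrow> potential k \<le> K * dissipation k"
proof -
  obtain \<kappa> where \<kappa>: "\<kappa> > 0" "\<And>w. \<kappa> * (norm w)\<^sup>2 \<le> (norm (transpose C *v w))\<^sup>2"
    using full_row_rank_bounds_transpose_below[OF full_row_rank] by blast
  obtain q where q: "q > 0" "\<And>w. norm (Q *v w) \<le> q * norm w"
    using bounded_linear.pos_bounded[OF matrix_vector_mul_bounded_linear[of Q]]
    by (auto simp: mult.commute)
  have sum_sq: "(s + t)\<^sup>2 \<le> 2 * s\<^sup>2 + 2 * t\<^sup>2" for s t :: real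
    using sum_squares_bound[of s t] by (simp add: power2_sum)
  \<comment> \<open>The potential is at most \<open>a1 * x + a2 * r + a3 * d\<close> and the dissipation at least
    \<open>c1 * x + c2 * r + c3 * d\<close>, for the squared norms \<open>x\<close>, \<open>r\<close>, \<open>d\<close> below.\<close>
  define a1 a2 a3 where "a1 = 4 * L\<^sup>2 / \<kappa> + bmax\<^sup>2 * lamM" and "a2 = 3 * ((\<gamma> - 1)\<^sup>2 * bmax\<^sup>2)"
    and "a3 = 4 * bmax\<^sup>2 * q\<^sup>2 / \<kappa> + bmax\<^sup>2 * q"
  define c1 c2 c3 where "c1 = \<epsilon> * \<sigma> * bmin" and "c2 = (1 + \<gamma> - \<gamma>\<^sup>2) * bmin\<^sup>2"
    and "c3 = 2 * \<sigma> * bmin"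
  have a_nonneg: "0 \<le> a1" "0 \<le> a2" "0 \<le> a3"
    using \<kappa>(1) q(1) lamM_nonneg by (simp_all add: a1_def a2_def a3_def)
  have c_pos: "0 < c1" "0 < c2" "0 < c3"
    using constants \<sigma>_pos golden_ratio_bound by (simp_all add: c1_def c2_def c3_def)
  define K where "K = a1 / c1 + a2 / c2 + a3 / c3 + 1"
  show ?thesis
  proof
    show "K > 0" using a_nonneg c_pos by (simp add: K_def add_nonneg_pos)
    fix k :: nat assume k: "k \<ge> 1"
    define \<beta> where "\<beta> = bk k"
    have \<beta>: "0 < \<beta>" "bmin \<le> \<beta>" "\<beta> \<le> bmax" "\<beta>\<^sup>2 \<le> bmax\<^sup>2" "bmin\<^sup>2 \<le> \<beta>\<^sup>2"
      using penalties[OF k] penalty_pos[OF k] constants(4) by (auto simp: \<beta>_def power_mono)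
    define x r d where "x = (norm (z (Suc k) - zs))\<^sup>2" and "r = (norm (res (Suc k)))\<^sup>2"
      and "d = (norm (z (Suc k) - z k))\<^sup>2"
    have nonneg: "0 \<le> x" "0 \<le> r" "0 \<le> d" by (simp_all add: x_def r_def d_def)
    let ?e = "l (Suc k) - ls"
    let ?p = "?e - ((\<gamma> - 1) * \<beta>) *\<^sub>R res (Suc k)"
    have "transpose C *v ?p = - (zsub k - - (transpose C *v ls)) - \<beta> *\<^sub>R (Q *v (z (Suc k) - z k))"
    proof -
      have "?p = (l k + \<beta> *\<^sub>R res (Suc k)) - ls"
        by (simp add: multiplier_step[OF k] \<beta>_def algebra_simps)
      then have "transpose C *v ?p = transpose C *v ((l k + \<beta> *\<^sub>R res (Suc k)) - ls)"
        by (rule arg_cong)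
      then show ?thesis
        by (simp only: zsub_def \<beta>_def matrix_vector_mult_diff_distrib) simp
    qed
    also have "zsub k = gradg (z (Suc k))"
      by (rule subgradient_eq_gradient[OF gradient z_subgradient[OF k]])
    also have "- (transpose C *v ls) = gradg zs"
      by (rule subgradient_eq_gradient[OF gradient zs_subgradient])
    finally have "norm (transpose C *v ?p)
        \<le> norm (gradg (z (Suc k)) - gradg zs) + norm (\<beta> *\<^sub>R (Q *v (z (Suc k) - z k)))"
      using norm_triangle_ineq4[of "- (gradg (z (Suc k)) - gradg zs)"
          "\<beta> *\<^sub>R (Q *v (z (Suc k) - z k))"]
      by (simp only: norm_minus_cancel)
    also have "\<dots> \<le> L * norm (z (Suc k) - zs) + \<beta> * (q * norm (z (Suc k) - z k))"
      using lipschitz_onD[OF lipschitz, of "z (Suc k)" zs] q(2) \<beta>(1)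
      by (intro add_mono) (auto simp: dist_norm)
    finally have "(norm (transpose C *v ?p))\<^sup>2
        \<le> (L * norm (z (Suc k) - zs) + \<beta> * (q * norm (z (Suc k) - z k)))\<^sup>2"
      by (intro power_mono) auto
    also have "\<dots> \<le> 2 * L\<^sup>2 * x + 2 * \<beta>\<^sup>2 * q\<^sup>2 * d"
      using sum_sq[of "L * norm (z (Suc k) - zs)" "\<beta> * (q * norm (z (Suc k) - z k))"]
      by (simp add: x_def d_def power_mult_distrib mult.assoc)
    also have "\<dots> \<le> 2 * L\<^sup>2 * x + 2 * bmax\<^sup>2 * q\<^sup>2 * d"
      using \<beta>(4) nonneg by (intro add_left_mono mult_right_mono mult_left_mono) auto
    finally have "\<kappa> * (norm ?p)\<^sup>2 \<le> 2 * L\<^sup>2 * x + 2 * bmax\<^sup>2 * q\<^sup>2 * d"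
      using \<kappa>(2)[of ?p] by linarith
    then have p: "(norm ?p)\<^sup>2 \<le> 2 * L\<^sup>2 / \<kappa> * x + 2 * bmax\<^sup>2 * q\<^sup>2 / \<kappa> * d"
      using \<kappa>(1) by (simp add: field_simps)
    have "norm ?e \<le> norm ?p + (\<gamma> - 1) * \<beta> * norm (res (Suc k))"
      using norm_triangle_ineq[of ?p "((\<gamma> - 1) * \<beta>) *\<^sub>R res (Suc k)"] \<beta>(1) constants(1) by simp
    then have "(norm ?e)\<^sup>2 \<le> (norm ?p + (\<gamma> - 1) * \<beta> * norm (res (Suc k)))\<^sup>2"
      by (intro power_mono) auto
    also have "\<dots> \<le> 2 * (norm ?p)\<^sup>2 + 2 * ((\<gamma> - 1)\<^sup>2 * \<beta>\<^sup>2 * r)"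
      using sum_sq[of "norm ?p" "(\<gamma> - 1) * \<beta> * norm (res (Suc k))"]
      by (simp add: r_def power_mult_distrib)
    also have "\<dots> \<le> 2 * (2 * L\<^sup>2 / \<kappa> * x + 2 * bmax\<^sup>2 * q\<^sup>2 / \<kappa> * d) + 2 * ((\<gamma> - 1)\<^sup>2 * bmax\<^sup>2 * r)"
      using p \<beta>(4) nonneg by (intro add_mono mult_right_mono mult_left_mono) auto
    finally have e: "(norm ?e)\<^sup>2
      \<le> 2 * (2 * L\<^sup>2 / \<kappa> * x + 2 * bmax\<^sup>2 * q\<^sup>2 / \<kappa> * d) + 2 * ((\<gamma> - 1)\<^sup>2 * bmax\<^sup>2 * r)" .
    have "(norm ?e)\<^sup>2 / \<gamma> \<le> (norm ?e)\<^sup>2"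
      using constants(1) by (simp add: divide_le_eq mult_le_cancel_left1)
    moreover have "(bk (Suc k))\<^sup>2 * qM (z (Suc k) - zs) \<le> bmax\<^sup>2 * (lamM * x)"
      using penalties[of "Suc k"] penalty_pos[of "Suc k"] qM_le qM_nonneg
      by (intro mult_mono) (auto simp: x_def power_mono)
    moreover have "(\<gamma> - 1)\<^sup>2 * \<beta>\<^sup>2 * r \<le> (\<gamma> - 1)\<^sup>2 * bmax\<^sup>2 * r"
      using \<beta>(4) nonneg by (intro mult_right_mono mult_left_mono) auto
    moreover have "\<beta>\<^sup>2 * qQ (z (Suc k) - z k) \<le> bmax\<^sup>2 * (q * d)"
    proof (intro mult_mono \<beta>(4) qQ_nonneg)
      let ?D = "z (Suc k) - z k"
      have "qQ ?D \<le> norm ?D * norm (Q *v ?D)"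
        unfolding qQ_def by (rule norm_cauchy_schwarz)
      also have "\<dots> \<le> norm ?D * (q * norm ?D)"
        using q(2) by (intro mult_left_mono) auto
      finally show "qQ ?D \<le> q * d" by (simp add: d_def power2_eq_square mult_ac)
    qed simp
    ultimately have "potential k \<le> a1 * x + a2 * r + a3 * d"
      using e unfolding potential_def \<beta>_def[symmetric] r_def[symmetric]
      by (simp add: a1_def a2_def a3_def algebra_simps)
    also have "\<dots> = a1 / c1 * (c1 * x) + a2 / c2 * (c2 * r) + a3 / c3 * (c3 * d)"
      using c_pos by simp
    also have "\<dots> \<le> K * (c1 * x) + K * (c2 * r) + K * (c3 * d)"
      using a_nonneg c_pos nonneg
      by (intro add_mono mult_right_mono) (auto simp: K_def)
    also have "\<dots> = K * (c1 * x + c2 * r + c3 * d)"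
      by (simp add: algebra_simps)
    also have "\<dots> \<le> K * dissipation k"
    proof (rule mult_left_mono)
      have "c1 * x \<le> \<epsilon> * \<sigma> * \<beta> * x" "c3 * d \<le> 2 * \<sigma> * \<beta> * d"
        unfolding c1_def c3_def using \<beta>(2) \<sigma>_pos constants nonneg
        by (intro mult_right_mono mult_left_mono; simp)+
      moreover have "c2 * r \<le> (1 + \<gamma> - \<gamma>\<^sup>2) * \<beta>\<^sup>2 * r"
        unfolding c2_def using \<beta>(5) golden_ratio_bound nonneg
        by (intro mult_right_mono mult_left_mono) auto
      moreover have "0 \<le> 2 * \<beta> * gap (Suc k)"
        using \<beta>(1) gap_nonneg[OF k] by simp
      ultimately show "c1 * x + c2 * r + c3 * d \<le> dissipation k"
        by (simp add: dissipation_def \<beta>_def x_def r_def d_def)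
    qed (use \<open>K > 0\<close> in simp)
    finally show "potential k \<le> K * dissipation k" .
  qed
qed

lemma potential_nonneg: "0 \<le> potential k"
  using constants(1) qM_nonneg qQ_nonneg by (simp add: potential_def)

lemma potential_geometric:
  obtains c \<rho> where "0 < \<rho>" "\<rho> < 1" "\<And>k. k \<ge> 1 \<Longrightarrow> potential k \<le> c * \<rho> ^ k"
proof -
  obtain K where K: "K > 0" "\<And>k. k \<ge> 1 \<Longrightarrow> potential k \<le> K * dissipation k"
    using potential_le_dissipation by blast
  define \<rho> where "\<rho> = K / (K + 1)"
  have \<rho>: "0 < \<rho>" "\<rho> < 1" using K(1) by (simp_all add: \<rho>_def)
  have contract: "potential (Suc k) \<le> \<rho> * potential k" if "k \<ge> 1" for k
  proof -
    have "K * (potential (Suc k) + dissipation (Suc k)) \<le> K * potential k"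
      using potential_descent[OF that] K(1) by simp
    then have "(K + 1) * potential (Suc k) \<le> K * potential k"
      using K(2)[of "Suc k"] by (simp add: algebra_simps)
    then show ?thesis using K(1) by (simp add: \<rho>_def field_simps)
  qed
  have "potential k \<le> potential 1 / \<rho> * \<rho> ^ k" if "k \<ge> 1" for k
    using that
  proof (induction k rule: dec_induct)
    case (step k)
    have "potential (Suc k) \<le> \<rho> * (potential 1 / \<rho> * \<rho> ^ k)"
      using contract[of k] step \<rho>(1) by (meson mult_left_mono less_imp_le order_trans)
    then show ?case by simp
  qed (use \<rho> in simp)
  with \<rho> show ?thesis by (rule that)
qed

section \<open>R-linear convergence\<close>

text \<open>
  The multiplier error is part of the potential. The Lagrangian gap and the residual are parts of
  the dissipation, which is at most the potential of the preceding iteration.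
\<close>
lemma R_linear_convergence:
  shows "R_linearly_to_zero (\<lambda>k. lagrangian f (\<lambda>w. ereal (g w)) B C b (y k, z k) ls
              - lagrangian f (\<lambda>w. ereal (g w)) B C b (ys, zs) ls)" (is ?Lag)
    and "R_linearly_to_zero (\<lambda>k. ereal ((norm (constr_op B C (y k, z k) - b))\<^sup>2))" (is ?Res)
    and "R_linearly_to_zero (\<lambda>k. ereal ((norm (l k - ls))\<^sup>2))" (is ?Mult)
proof -
  obtain c \<rho> where \<rho>: "0 < \<rho>" "\<rho> < 1"
    and geometric: "\<And>k. k \<ge> 1 \<Longrightarrow> potential k \<le> c * \<rho> ^ k"
    using potential_geometric by blast
  define \<delta> where "\<delta> = 1 + \<gamma> - \<gamma>\<^sup>2"
  have \<delta>: "\<delta> > 0" using golden_ratio_bound by (simp add: \<delta>_def)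
  have bounds: "2 * bmin * gap (Suc (Suc k)) \<le> potential k"
      "\<delta> * bmin\<^sup>2 * (norm (res (Suc (Suc k))))\<^sup>2 \<le> potential k"
    if k: "k \<ge> 1" for k
  proof -
    let ?\<beta> = "bk (Suc k)" and ?r = "(norm (res (Suc (Suc k))))\<^sup>2" and ?G = "gap (Suc (Suc k))"
    have pos: "0 < ?\<beta>" and ge: "bmin \<le> ?\<beta>" "bmin\<^sup>2 \<le> ?\<beta>\<^sup>2"
      using penalty_pos[of "Suc k"] penalties[of "Suc k"] constants(4) by (auto simp: power_mono)
    have G: "0 \<le> ?G" by (rule gap_nonneg) simp
    have "0 \<le> \<epsilon> * \<sigma> * ?\<beta> * (norm (z (Suc (Suc k)) - zs))\<^sup>2"
      "0 \<le> 2 * \<sigma> * ?\<beta> * (norm (z (Suc (Suc k)) - z (Suc k)))\<^sup>2"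
      "0 \<le> 2 * ?\<beta> * ?G" "0 \<le> \<delta> * ?\<beta>\<^sup>2 * ?r"
      using pos \<sigma>_pos constants \<delta> G by simp_all
    then have "2 * ?\<beta> * ?G \<le> potential k" "\<delta> * ?\<beta>\<^sup>2 * ?r \<le> potential k"
      using potential_descent[OF k] potential_nonneg[of "Suc k"]
      unfolding dissipation_def \<delta>_def[symmetric] by linarith+
    moreover have "2 * bmin * ?G \<le> 2 * ?\<beta> * ?G" "\<delta> * bmin\<^sup>2 * ?r \<le> \<delta> * ?\<beta>\<^sup>2 * ?r"
      using ge G \<delta> by (intro mult_right_mono mult_left_mono; simp)+
    ultimately show "2 * bmin * ?G \<le> potential k" "\<delta> * bmin\<^sup>2 * ?r \<le> potential k"
      by linarith+
  qed
  show ?Lag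
  proof (rule R_linearly_to_zeroI[OF lagrangian_gap_nonneg \<rho>])
    fix k :: nat assume k: "k \<ge> 1"
    have "gap (Suc (Suc k)) \<le> c / (2 * bmin) * \<rho> ^ k"
      using bounds(1)[OF k] geometric[OF k] constants(4) by (simp add: field_simps)
    then show "lagrangian f (\<lambda>w. ereal (g w)) B C b (y (k + 2), z (k + 2)) ls
              - lagrangian f (\<lambda>w. ereal (g w)) B C b (ys, zs) ls \<le> ereal (c / (2 * bmin) * \<rho> ^ k)"
      using lagrangian_gap_eq[of "Suc k"] by simp
  qed
  show ?Res
  proof (rule R_linearly_to_zeroI[OF _ \<rho>])
    fix k :: nat assume k: "k \<ge> 1"
    have "(norm (res (Suc (Suc k))))\<^sup>2 \<le> c / (\<delta> * bmin\<^sup>2) * \<rho> ^ k"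
      using bounds(2)[OF k] geometric[OF k] constants(4) \<delta> by (simp add: field_simps)
    then show "ereal ((norm (constr_op B C (y (k + 2), z (k + 2)) - b))\<^sup>2)
        \<le> ereal (c / (\<delta> * bmin\<^sup>2) * \<rho> ^ k)"
      by (simp add: res_def constr_op_def)
  qed simp
  show ?Mult
  proof (rule R_linearly_to_zeroI[OF _ \<rho>])
    fix k :: nat assume k: "k \<ge> 1"
    have "(norm (l (Suc k) - ls))\<^sup>2 / \<gamma> \<le> potential k"
      using qM_nonneg qQ_nonneg by (simp add: potential_def)
    then have "(norm (l (Suc k) - ls))\<^sup>2 / \<gamma> \<le> c * \<rho> ^ k"
      using geometric[OF k] by linarith
    then have "(norm (l (Suc k) - ls))\<^sup>2 \<le> \<gamma> * c * \<rho> ^ k"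
      using constants(1) by (simp add: field_simps)
    then show "ereal ((norm (l (k + 1) - ls))\<^sup>2) \<le> ereal (\<gamma> * c * \<rho> ^ k)"
      by simp
  qed simp
qed

end

theorem theorem3p9:
  fixes f :: "real^'n1 \<Rightarrow> ereal" and g :: "real^'n2 \<Rightarrow> real"
    and gradg :: "real^'n2 \<Rightarrow> real^'n2"
    and B :: "real^'n1^'m" and C :: "real^'n2^'m" and b :: "real^'m"
    and Q :: "real^'n2^'n2"
    and y :: "nat \<Rightarrow> real^'n1" and z :: "nat \<Rightarrow> real^'n2" and l :: "nat \<Rightarrow> real^'m"
    and bk :: "nat \<Rightarrow> real"
    and ystar :: "real^'n1" and zstar :: "real^'n2" and lstar :: "real^'m"
    and \<sigma>\<^sub>g L\<^sub>g \<gamma> \<epsilon> bmin bmax \<tau> :: real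
  assumes f: "proper f" "lower_semicontinuous f" "convex_ereal f"
    and g: "proper (\<lambda>w. ereal (g w))" "lower_semicontinuous (\<lambda>w. ereal (g w))"
           "convex_ereal (\<lambda>w. ereal (g w))"
    and strong: "\<sigma>\<^sub>g > 0" "strongly_convex \<sigma>\<^sub>g (\<lambda>w. ereal (g w))"
    and smooth: "\<And>w. GDERIV g w :> gradg w" "continuous_on UNIV gradg"
    and lipschitz: "L\<^sub>g-lipschitz_on UNIV gradg"
    and full_row_rank: "rank C = CARD('m)"
    and algorithm: "IADMM f (\<lambda>w. ereal (g w)) B C b \<sigma>\<^sub>g \<gamma> \<epsilon> bmin \<tau> Q y z l bk"
    and penalties: "\<And>k. k \<ge> 1 \<Longrightarrow> bmin \<le> bk k \<and> bk k \<le> bmax"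
    and KKT: "KKT_solution f (\<lambda>w. ereal (g w)) B C b (ystar, zstar) lstar"
  shows "R_linearly_to_zero
           (\<lambda>k. lagrangian f (\<lambda>w. ereal (g w)) B C b (y k, z k) lstar
              - lagrangian f (\<lambda>w. ereal (g w)) B C b (ystar, zstar) lstar) \<and>
         R_linearly_to_zero (\<lambda>k. ereal ((norm (constr_op B C (y k, z k) - b))\<^sup>2)) \<and>
         R_linearly_to_zero (\<lambda>k. ereal ((norm (l k - lstar))\<^sup>2))"
proof -
  interpret iadmm_run f g gradg B C b Q y z l bk ystar zstar lstar \<sigma>\<^sub>g L\<^sub>g \<gamma> \<epsilon> bmin bmax \<tau>
    using f g strong smooth lipschitz full_row_rank algorithm penalties KKT by unfold_locales auto
  show ?thesis
    using R_linear_convergence by blast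
qed

end
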